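(* For every positive integer $n$ and every $i \in \{1,\dots,n\}$, $\beta_{[\pm i]}(n) = \lceil \frac{n}{2i} \rceil$.
   Context: For a positive integer $n$, $[n]=\{1,\dots,n\}$. For a set $D$ of integers and families $\mathcal{F},\mathcal{F}'$ of subsets of $[n]$, $\mathcal{F}'$ is called $D$-secting for $\mathcal{F}$ if for every $A\in\mathcal{F}$ there exists $A'\in\mathcal{F}'$ with $|A\cap A'|-|A\cap([n]\setminus A')|\in D$. $\beta_D(\mathcal{F})$ denotes the minimum cardinality of a $D$-secting family for $\mathcal{F}$. $[\pm i]$ denotes the set of integers $\{-i,-i+1,\dots,i\}$, and $\beta_{[\pm i]}(\mathcal{F})=\beta_D(\mathcal{F})$ with $D=[\pm i]$. $\beta_{[\pm i]}(n)$ is the maximum of $\beta_{[\pm i]}(\mathcal{F})$ over all families $\mathcal{F}$ of subsets of $[n]$. *)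

theory Defs
  imports Complex_Main
begin

definition secting :: "nat \<Rightarrow> int set \<Rightarrow> nat set set \<Rightarrow> nat set set \<Rightarrow> bool" where
  "secting n D F F' \<longleftrightarrow>
     F' \<subseteq> Pow {1..n} \<and>
     (\<forall>A\<in>F. \<exists>A'\<in>F'. int (card (A \<inter> A')) - int (card (A \<inter> ({1..n} - A'))) \<in> D)"

text \<open>
  The value is unspecified if \<open>F\<close> has no \<open>D\<close>-secting family. For \<open>D = {- int i..int i}\<close>
  with \<open>i \<ge> 1\<close> and \<open>F \<subseteq> Pow {1..n}\<close> there always is one, namely \<open>Pow {1..n}\<close>.
\<close>
definition beta :: "nat \<Rightarrow> int set \<Rightarrow> nat set set \<Rightarrow> nat" where
  "beta n D F = (LEAST k. \<exists>F'. secting n D F F' \<and> card F' = k)"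

definition beta_pm :: "nat \<Rightarrow> nat \<Rightarrow> nat" where
  "beta_pm i n = Max (beta n {- int i..int i} ` Pow (Pow {1..n}))"

end

theory Submission
  imports Defs
begin

text \<open>
  Upper bound: let \<open>k = \<lceil>n / 2i\<rceil>\<close> and slide a window of length \<open>ik\<close> through \<open>{1..2ik} \<supseteq> {1..n}\<close>
  in steps of \<open>i\<close>. The discrepancy of \<open>A\<close> changes by at most \<open>2i\<close> per step, and after \<open>k\<close> steps
  the window has become its complement, so the discrepancy has changed sign. Hence it lies in
  \<open>{-i..i}\<close> for one of the first \<open>k\<close> windows.

  Lower bound: suppose \<open>k\<close> sets section all subsets of \<open>{1..n}\<close>. Multiply, over these sets, the
  factors \<open>L - d\<close>, where \<open>L\<close> is the discrepancy as a linear form in the indicator vector and \<open>d\<close>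
  ranges over the \<open>i\<close> elements of \<open>{-i..i}\<close> with \<open>d \<equiv> i + 1 (mod 2)\<close>. As \<open>L\<close> has the parity of
  \<open>card A\<close>, this polynomial \<open>P\<close> of degree \<open>ki\<close> vanishes at all \<open>A\<close> with \<open>card A \<equiv> i + 1 (mod 2)\<close>
  and at no other \<open>A\<close>. So the alternating sum of \<open>P\<^sup>2\<close> over the cube is nonzero, which forces
  \<open>2ki \<ge> n\<close>.
\<close>

text \<open>On indicator vectors the product is a combination of monomials, each in at most
  \<open>card I\<close> elements of \<open>S\<close>. Every monomial misses some element, and
  toggling that element cancels its alternating sum. The induction expands one factor at a time
  instead of passing to monomials.\<close>

lemma alternating_sum_prod_affine_eq_0:
  fixes w :: "'l \<Rightarrow> 'a \<Rightarrow> int"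
  assumes "finite I" "finite S" "card I < card S"
  shows "(\<Sum>A\<in>Pow S. (-1) ^ card A * (\<Prod>l\<in>I. c l + (\<Sum>x\<in>A. w l x))) = 0"
  using assms
proof (induction I arbitrary: S c rule: finite_induct)
  case empty
  then have "S \<noteq> {}" by auto
  then obtain x where x: "x \<in> S" by blast
  let ?T = "S - {x}"
  have "Pow S = Pow ?T \<union> insert x ` Pow ?T"
    using x by (metis Pow_insert insert_Diff)
  moreover have "inj_on (insert x) (Pow ?T)"
    by (auto simp: inj_on_def)
  moreover have "Pow ?T \<inter> insert x ` Pow ?T = {}" by auto
  ultimately have "(\<Sum>A\<in>Pow S. (-1::int) ^ card A)
      = (\<Sum>A\<in>Pow ?T. (-1) ^ card A) + (\<Sum>A\<in>Pow ?T. (-1) ^ card (insert x A))"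
    using empty by (simp add: sum.union_disjoint sum.reindex)
  also have "(\<Sum>A\<in>Pow ?T. (-1::int) ^ card (insert x A)) = (\<Sum>A\<in>Pow ?T. - ((-1) ^ card A))"
  proof (rule sum.cong)
    fix A assume "A \<in> Pow ?T"
    then have "x \<notin> A" "finite A" using empty finite_subset by auto
    then show "(-1::int) ^ card (insert x A) = - ((-1) ^ card A)" by simp
  qed simp
  finally show ?case by (simp add: sum_negf)
next
  case (insert l I)
  define P where "P c A = (\<Prod>m\<in>I. c m + (\<Sum>x\<in>A. w m x))" for c A
  \<comment> \<open>Deleting \<open>x\<close> from the sets containing it flips the sign and shifts
    each constant \<open>c m\<close> by \<open>w m x\<close>, so the induction hypothesis applies to
    \<open>S - {x}\<close>.\<close>
  have vanish: "(\<Sum>A | A \<subseteq> S \<and> x \<in> A. (-1) ^ card A * P c A) = 0" if x: "x \<in> S" for x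
  proof -
    let ?T = "S - {x}"
    have "{A. A \<subseteq> S \<and> x \<in> A} = insert x ` Pow ?T"
    proof (intro equalityI subsetI)
      fix A assume "A \<in> {A. A \<subseteq> S \<and> x \<in> A}"
      then have "A = insert x (A - {x})" "A - {x} \<in> Pow ?T" by auto
      then show "A \<in> insert x ` Pow ?T" by blast
    qed (use x in auto)
    moreover have "inj_on (insert x) (Pow ?T)"
      by (auto simp: inj_on_def)
    ultimately have "(\<Sum>A | A \<subseteq> S \<and> x \<in> A. (-1) ^ card A * P c A)
        = (\<Sum>A\<in>Pow ?T. (-1) ^ card (insert x A) * P c (insert x A))"
      by (simp add: sum.reindex)
    also have "\<dots> = (\<Sum>A\<in>Pow ?T. - ((-1) ^ card A * P (\<lambda>m. c m + w m x) A))"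
    proof (rule sum.cong)
      fix A assume "A \<in> Pow ?T"
      then have "x \<notin> A" "finite A" using insert finite_subset[of A ?T] by auto
      then show "(-1) ^ card (insert x A) * P c (insert x A)
          = - ((-1) ^ card A * P (\<lambda>m. c m + w m x) A)"
        by (simp add: P_def add.assoc)
    qed simp
    also have "\<dots> = 0"
      using insert.IH[of ?T "\<lambda>m. c m + w m x"] insert.prems insert.hyps x
      by (simp add: sum_negf P_def)
    finally show ?thesis .
  qed
  have "(\<Sum>A\<in>Pow S. (-1) ^ card A * (\<Prod>m\<in>insert l I. c m + (\<Sum>x\<in>A. w m x)))
      = (\<Sum>A\<in>Pow S. c l * ((-1) ^ card A * P c A)
          + (\<Sum>x\<in>A. w l x * ((-1) ^ card A * P c A)))"
    using insert.hyps
    by (intro sum.cong refl) (simp add: P_def distrib_left distrib_right mult_ac flip: sum_distrib_right)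
  also have "\<dots> = c l * (\<Sum>A\<in>Pow S. (-1) ^ card A * P c A)
      + (\<Sum>A\<in>Pow S. \<Sum>x\<in>A. w l x * ((-1) ^ card A * P c A))"
    by (simp add: sum.distrib sum_distrib_left)
  also have "(\<Sum>A\<in>Pow S. (-1) ^ card A * P c A) = 0"
    using insert.IH[of S c] insert.prems insert.hyps by (simp add: P_def)
  also have "(\<Sum>A\<in>Pow S. \<Sum>x\<in>A. w l x * ((-1) ^ card A * P c A))
      = (\<Sum>A\<in>Pow S. \<Sum>x | x \<in> S \<and> x \<in> A. w l x * ((-1) ^ card A * P c A))"
    by (intro sum.cong) auto
  also have "\<dots> = (\<Sum>x\<in>S. \<Sum>A | A \<in> Pow S \<and> x \<in> A. w l x * ((-1) ^ card A * P c A))"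
    using insert.prems by (intro sum.swap_restrict) auto
  also have "\<dots> = (\<Sum>x\<in>S. w l x * (\<Sum>A | A \<subseteq> S \<and> x \<in> A. (-1) ^ card A * P c A))"
    by (simp add: sum_distrib_left)
  also have "\<dots> = 0"
    using vanish by simp
  finally show ?case by simp
qed

text \<open>Turns the discrepancy into a linear form, as
  \<open>alternating_sum_prod_affine_eq_0\<close> requires.\<close>

lemma sum_signs_eq_discrepancy:
  fixes n :: nat
  assumes "A \<subseteq> {1..n}"
  shows "(\<Sum>x\<in>A. if x \<in> B then 1 else -1 :: int)
    = int (card (A \<inter> B)) - int (card (A \<inter> ({1..n} - B)))"
proof -
  have fin: "finite A" using assms finite_subset by blast
  have "A \<inter> ({1..n} - B) = A \<inter> - B" using assms by auto
  then show ?thesis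
    using fin by (simp add: sum.If_cases)
qed

lemma even_discrepancy_iff:
  fixes n :: nat
  assumes "A \<subseteq> {1..n}"
  shows "even (int (card (A \<inter> B)) - int (card (A \<inter> ({1..n} - B)))) \<longleftrightarrow> even (card A)"
proof -
  have "finite A" using assms finite_subset by blast
  moreover have "(A \<inter> B) \<union> (A \<inter> ({1..n} - B)) = A" using assms by auto
  ultimately have "card A = card (A \<inter> B) + card (A \<inter> ({1..n} - B))"
    using card_Un_disjoint[of "A \<inter> B" "A \<inter> ({1..n} - B)"] by auto
  then show ?thesis by simp
qed

lemma secting_Pow_card_ge:
  assumes "i \<le> n" "secting n {- int i..int i} (Pow {1..n}) F"
  shows "n \<le> 2 * i * card F"
proof (rule ccontr)
  assume small: "\<not> n \<le> 2 * i * card F"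
  \<comment> \<open>The values \<open>-i + 1\<close>, \<open>-i + 3\<close>, ...,
    \<open>i - 1\<close>: the members of \<open>{-i..i}\<close> whose parity differs from that of
    \<open>i\<close>.\<close>
  define D where "D = (\<lambda>j. 2 * int j - int i + 1) ` {..<i}"
  define disc where "disc B A = int (card (A \<inter> B)) - int (card (A \<inter> ({1..n} - B)))" for A B
  have parity: "even (disc B A) \<longleftrightarrow> even (card A)" if "A \<subseteq> {1..n}" for A B
    unfolding disc_def using that by (rule even_discrepancy_iff)
  have "F \<subseteq> Pow {1..n}" using assms(2) by (simp add: secting_def)
  then have finF: "finite F" using finite_subset by blast
  have finD: "finite D" by (simp add: D_def)
  have "card D \<le> i" unfolding D_def using card_image_le[of "{..<i}"] by simp
  \<comment> \<open>The boolean component duplicates every factor, so that the product below is a square.\<close>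
  let ?I = "(F \<times> D) \<times> (UNIV :: bool set)"
  define P where "P A = (\<Prod>(B, d)\<in>F \<times> D. disc B A - d)" for A
  have "card ?I \<le> 2 * i * card F"
    using \<open>card D \<le> i\<close> by (simp add: card_cartesian_product)
  then have "card ?I < card {1..n}" using small by simp
  then have affine: "(\<Sum>A\<in>Pow {1..n}. (-1) ^ card A * (\<Prod>l\<in>?I. - snd (fst l)
      + (\<Sum>x\<in>A. if x \<in> fst (fst l) then 1 else -1 :: int))) = 0"
    using finF finD by (intro alternating_sum_prod_affine_eq_0) auto
  have square: "(\<Prod>l\<in>?I. - snd (fst l)
      + (\<Sum>x\<in>A. if x \<in> fst (fst l) then 1 else -1 :: int)) = (P A)\<^sup>2" if "A \<in> Pow {1..n}" for A
  proof -
    have "(\<Prod>l\<in>?I. - snd (fst l) + (\<Sum>x\<in>A. if x \<in> fst (fst l) then 1 else -1 :: int))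
        = (\<Prod>(p, b)\<in>?I. disc (fst p) A - snd p)"
      using that by (intro prod.cong) (auto simp: sum_signs_eq_discrepancy disc_def)
    also have "\<dots> = (\<Prod>p\<in>F \<times> D. \<Prod>b\<in>(UNIV :: bool set). disc (fst p) A - snd p)"
      using prod.cartesian_product[of "\<lambda>p b. disc (fst p) A - snd p" "UNIV :: bool set" "F \<times> D"]
      by simp
    also have "\<dots> = (P A)\<^sup>2"
      by (simp add: P_def case_prod_beta prod_power_distrib)
    finally show ?thesis .
  qed
  have alternating: "(\<Sum>A\<in>Pow {1..n}. (-1) ^ card A * (P A)\<^sup>2) = 0"
    by (rule trans[OF sum.cong affine]) (simp_all only: square)
  \<comment> \<open>All nonzero terms share one sign: where the parities of \<open>card A\<close>
    and \<open>i\<close> differ, the member of \<open>F\<close> that sects \<open>A\<close> gives a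
    zero factor of \<open>P A\<close>. Up to sign, the alternating sum is thus a sum of
    squares.\<close>
  have sign: "(-1) ^ card A * (P A)\<^sup>2 = (-1) ^ i * (P A)\<^sup>2" if A: "A \<in> Pow {1..n}" for A
  proof (cases "even (card A) = even i")
    case True
    then show ?thesis by (simp add: uminus_power_if)
  next
    case False
    obtain B where B: "B \<in> F" "disc B A \<in> {- int i..int i}"
      using assms(2) A unfolding secting_def disc_def by blast
    have "odd (disc B A + int i)"
      using parity[of A B] A False by auto
    then obtain m where m: "disc B A + int i = 2 * m + 1" by (rule oddE)
    with B have "0 \<le> m" "m < int i" by auto
    then have "disc B A = 2 * int (nat m) - int i + 1" "nat m < i"
      using m by auto
    then have "disc B A \<in> D" unfolding D_def by blast
    with B have "P A = 0"
      unfolding P_def using finF finD by (intro prod_zero) (auto intro!: bexI[of _ "(B, disc B A)"])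
    then show ?thesis by simp
  qed
  have "(\<Sum>A\<in>Pow {1..n}. (-1) ^ i * (P A)\<^sup>2) = 0"
    by (rule trans[OF sum.cong alternating]) (simp_all only: sign)
  then have "(\<Sum>A\<in>Pow {1..n}. (P A)\<^sup>2) = 0"
    by (simp flip: sum_distrib_left)
  then have zero: "P A = 0" if "A \<subseteq> {1..n}" for A
    using that by (subst (asm) sum_nonneg_eq_0_iff) auto
  \<comment> \<open>On a set of size \<open>i\<close> every discrepancy has the parity of
    \<open>i\<close>, which no \<open>d\<close> in \<open>D\<close> has, so no factor
    vanishes.\<close>
  have "P {1..i} \<noteq> 0"
  proof -
    have "disc B {1..i} \<noteq> d" if "d \<in> D" for B d
    proof
      assume "disc B {1..i} = d"
      then have "even d \<longleftrightarrow> even i"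
        using parity[of "{1..i}" B] assms(1) by auto
      with that show False by (auto simp: D_def)
    qed
    then show ?thesis using finF finD by (auto simp: P_def)
  qed
  then show False using zero assms(1) by auto
qed

text \<open>Crossing from above \<open>r\<close> to below \<open>-r\<close> takes a step of at least
  \<open>2 * r + 2\<close>. A walk avoiding \<open>{-r..r}\<close> before time \<open>k\<close>
  therefore keeps its side, and its last step cannot reach \<open>- g 0\<close>.\<close>

lemma antisymmetric_walk_near_0:
  fixes g :: "nat \<Rightarrow> int"
  assumes step: "\<And>j. \<bar>g (Suc j) - g j\<bar> \<le> 2 * r" and "g k = - g 0" and "0 < k"
  shows "\<exists>j<k. \<bar>g j\<bar> \<le> r"
proof (rule ccontr)
  assume "\<not> ?thesis"
  then have far: "\<bar>g j\<bar> > r" if "j < k" for j using that by force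
  have same_side: "(g 0 > r \<longrightarrow> g j > r) \<and> (g 0 < - r \<longrightarrow> g j < - r)" if "j < k" for j
    using that
  proof (induction j)
    case (Suc j)
    then show ?case using far[of "Suc j"] step[of j] by auto
  qed simp
  obtain j where "k = Suc j" using \<open>0 < k\<close> gr0_implies_Suc by blast
  then show False
    using far[of 0] same_side[of j] step[of j] assms(2) by auto
qed

lemma secting_exists_card_le:
  assumes "0 < k" "n \<le> 2 * i * k" "\<F> \<subseteq> Pow {1..n}"
  shows "\<exists>F. secting n {- int i..int i} \<F> F \<and> card F \<le> k"
proof -
  \<comment> \<open>\<open>W 0\<close> and \<open>W k\<close> are the two halves of
    \<open>{1..2 * i * k}\<close>, and a shift by one index drops \<open>i\<close> points and adds
    \<open>i\<close>. Windows may extend beyond \<open>n\<close>, hence the intersection in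
    \<open>?F\<close>.\<close>
  define W where "W j = {j * i + 1..j * i + i * k}" for j
  let ?F = "(\<lambda>j. W j \<inter> {1..n}) ` {..<k}"
  have "\<exists>B\<in>?F. int (card (A \<inter> B)) - int (card (A \<inter> ({1..n} - B))) \<in> {- int i..int i}"
    if "A \<in> \<F>" for A
  proof -
    have A: "A \<subseteq> {1..n}" using that assms(3) by blast
    then have fin: "finite A" using finite_subset by blast
    \<comment> \<open>The discrepancy of \<open>A\<close> at \<open>W j\<close>, with
      \<open>card (A - W j)\<close> eliminated.\<close>
    define g where "g j = 2 * int (card (A \<inter> W j)) - int (card A)" for j
    have move: "card (A \<inter> X) \<le> card (A \<inter> Y) + i" if "X \<subseteq> Y \<union> Z" "finite Z" "card Z \<le> i" for X Y Z
    proof -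
      have "card (A \<inter> X) \<le> card ((A \<inter> Y) \<union> Z)"
        using that fin by (intro card_mono) auto
      also have "\<dots> \<le> card (A \<inter> Y) + card Z" by (rule card_Un_le)
      finally show ?thesis using that by simp
    qed
    have "\<bar>g (Suc j) - g j\<bar> \<le> 2 * int i" for j
    proof -
      have "card (A \<inter> W (Suc j)) \<le> card (A \<inter> W j) + i"
        by (rule move[where Z = "{j * i + i * k + 1..j * i + i * k + i}"]) (auto simp: W_def)
      moreover have "card (A \<inter> W j) \<le> card (A \<inter> W (Suc j)) + i"
        by (rule move[where Z = "{j * i + 1..j * i + i}"]) (auto simp: W_def)
      ultimately show ?thesis by (simp add: g_def)
    qed
    moreover have "g k = - g 0"
    proof -
      have "A = (A \<inter> W 0) \<union> (A \<inter> W k)"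
      proof -
        have "W 0 \<union> W k = {1..2 * i * k}" by (auto simp: W_def mult.commute[of k i])
        moreover have "{1..n} \<subseteq> {1..2 * i * k}" using assms(2) by simp
        ultimately show ?thesis using A by blast
      qed
      moreover have "(A \<inter> W 0) \<inter> (A \<inter> W k) = {}"
        by (auto simp: W_def mult.commute)
      ultimately have "card A = card (A \<inter> W 0) + card (A \<inter> W k)"
        using fin by (metis card_Un_disjoint finite_Int)
      then show ?thesis by (simp add: g_def)
    qed
    ultimately obtain j where j: "j < k" "\<bar>g j\<bar> \<le> int i"
      using antisymmetric_walk_near_0[of g "int i" k] assms(1) by auto
    let ?B = "W j \<inter> {1..n}"
    have "A \<inter> ?B = A \<inter> W j" "A \<inter> ({1..n} - ?B) = A - W j"
      using A by auto
    moreover have "card A = card (A \<inter> W j) + card (A - W j)"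
      using fin card_Int_Diff by blast
    ultimately have "int (card (A \<inter> ?B)) - int (card (A \<inter> ({1..n} - ?B))) = g j"
      by (simp add: g_def)
    with j show ?thesis by (intro bexI[of _ ?B]) auto
  qed
  then have "secting n {- int i..int i} \<F> ?F"
    unfolding secting_def by blast
  moreover have "card ?F \<le> k"
    using card_image_le[of "{..<k}"] by simp
  ultimately show ?thesis by blast
qed

theorem theorem1:
  fixes n i :: nat
  assumes "n \<ge> 1" and "i \<in> {1..n}"
  shows "int (beta_pm i n) = \<lceil>real n / (2 * real i)\<rceil>"
proof -
  define k where "k = nat \<lceil>real n / (2 * real i)\<rceil>"
  have i: "0 < i" "i \<le> n" using assms by auto
  \<comment> \<open>Thus \<open>k\<close> is the least \<open>m\<close> with
    \<open>n \<le> 2 * i * m\<close>, the form that both bounds use.\<close>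
  have le_iff: "k \<le> m \<longleftrightarrow> n \<le> 2 * i * m" for m
  proof -
    have "k \<le> m \<longleftrightarrow> real n / (2 * real i) \<le> real m"
      by (simp add: k_def nat_le_iff ceiling_le_iff)
    also have "\<dots> \<longleftrightarrow> real n \<le> real (2 * i * m)"
      using i by (simp add: field_simps)
    finally show ?thesis by (simp only: of_nat_le_iff)
  qed
  have k: "0 < k" "n \<le> 2 * i * k"
    using le_iff[of 0] le_iff[of k] assms by auto
  let ?D = "{- int i..int i}"
  have upper: "beta n ?D \<F> \<le> k" if sub: "\<F> \<subseteq> Pow {1..n}" for \<F>
  proof -
    obtain F where F: "secting n ?D \<F> F" "card F \<le> k"
      using secting_exists_card_le[OF k sub] by blast
    then have "beta n ?D \<F> \<le> card F"
      unfolding beta_def by (intro Least_le) blast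
    with F show ?thesis by simp
  qed
  have "k \<le> beta n ?D (Pow {1..n})"
  proof -
    \<comment> \<open>Some secting family must exist for the \<open>LEAST\<close> in
      \<open>beta\<close> to be attained.\<close>
    have "\<exists>m F. secting n ?D (Pow {1..n}) F \<and> card F = m"
      using secting_exists_card_le[OF k] by blast
    then have "\<exists>F. secting n ?D (Pow {1..n}) F \<and> card F = beta n ?D (Pow {1..n})"
      unfolding beta_def by (rule LeastI_ex)
    then show ?thesis
      using secting_Pow_card_ge[OF i(2)] le_iff by metis
  qed
  then have "beta n ?D (Pow {1..n}) = k"
    using upper by (simp add: order_antisym)
  then have "beta_pm i n = k"
    unfolding beta_pm_def using upper by (intro Max_eqI) auto
  moreover have "0 \<le> \<lceil>real n / (2 * real i)\<rceil>"
    by (simp add: order.strict_trans2[of "-1" 0])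
  ultimately show ?thesis by (simp add: k_def)
qed

end
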